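(* Any composition of a finite number of maps $\mathbb{R}^2\to\mathbb{R}^2$, each of which is of one of the following types, is a taxicab isometry: \begin{itemize} \item a translation of the plane, $(x,y)\mapsto(x+a,y+b)$ with $a,b\in\mathbb{R}$; \item a taxicab rotation about the origin by $2n$ $t$-radians, for an integer $n$; \item a taxicab reflection across one of the lines $y=x$, $y=-x$, $y=0$, $x=0$. \end{itemize} In particular, each of the listed maps is itself a taxicab isometry.
   Context: The taxicab metric on $\mathbb{R}^2$ is $d_T((x_1,y_1),(x_2,y_2))=|x_1-x_2|+|y_1-y_2|$. A taxicab isometry is a map $f:\mathbb{R}^2\to\mathbb{R}^2$ such that $d_T(P,Q)=d_T(f(P),f(Q))$ for all $P,Q\in\mathbb{R}^2$. The taxicab circle with center $C$ and radius $\rho>0$ is $\{P: d_T(P,C)=\rho\}$. A $t$-radian is an angle whose vertex is the center of a unit taxicab circle and which intercepts an arc of (taxicab) length $1$ on it; the taxicab measure of an angle is the number of $t$-radians it subtends on the unit taxicab circle about its vertex (the whole circle has length $8$). The taxicab rotation of a point $P$ by $r$ $t$-radians about a point $Q$ sends $P$ to the point $P'$ reached by moving counterclockwise along the taxicab circle of radius $d_T(P,Q)$ centered at $Q$ so that $d_T(P,Q)=d_T(P',Q)$ and the angle swept out from $QP$ to $QP'$ has taxicab measure $r$, i.e. the arc traversed has taxicab length $r\,d_T(P,Q)$ (clockwise if $r<0$; $Q$ itself is fixed). The taxicab reflection of a point $P$ across a line $l$ is the point $P'$ such that the midpoint $M$ of $PP'$ lies on $l$, $d_T(P,M)=d_T(P',M)$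 and $PP'\perp l$ (with $P'=P$ if $P\in l$). Midpoints are the usual coordinate midpoints, and perpendicularity is the usual Euclidean one. *)

theory Defs
  imports "HOL-Analysis.Analysis"
begin

type_synonym plane = "real \<times> real"

definition taxicab_dist :: "plane \<Rightarrow> plane \<Rightarrow> real" where
  "taxicab_dist P Q = \<bar>fst P - fst Q\<bar> + \<bar>snd P - snd Q\<bar>"

definition taxicab_isometry :: "(plane \<Rightarrow> plane) \<Rightarrow> bool" where
  "taxicab_isometry f \<longleftrightarrow> (\<forall>P Q. taxicab_dist P Q = taxicab_dist (f P) (f Q))"

definition taxicab_circle :: "plane \<Rightarrow> real \<Rightarrow> plane set" where
  "taxicab_circle C \<rho> = {P. taxicab_dist P C = \<rho>}"

text \<open>Length of a curve parametrised by the unit interval, as a supremum over the subdivisions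
  \<open>t 0 \<le> \<dots> \<le> t n\<close>. A part of a curve that is traversed several times counts several times.\<close>

definition taxicab_length :: "(real \<Rightarrow> plane) \<Rightarrow> ennreal" where
  "taxicab_length g =
     (SUP (n, t) \<in> {(n :: nat, t :: nat \<Rightarrow> real). mono_on {..n} t \<and> t ` {..n} \<subseteq> {0..1}}.
        \<Sum>i<n. ennreal (taxicab_dist (g (t i)) (g (t (Suc i)))))"

definition radial_projection :: "plane \<Rightarrow> plane \<Rightarrow> plane" where
  "radial_projection Q P = Q + (1 / taxicab_dist P Q) *\<^sub>R (P - Q)"

text \<open>Taxicab measure of the angle that the ray from \<open>Q\<close> through the moving point \<open>g t\<close> sweeps out:
  the length of the arc (number of t-radians) on the unit taxicab circle about \<open>Q\<close>.\<close>

definition t_radians_swept :: "plane \<Rightarrow> (real \<Rightarrow> plane) \<Rightarrow> ennreal" where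
  "t_radians_swept Q g = taxicab_length (\<lambda>t. radial_projection Q (g t))"

text \<open>Moving counterclockwise about \<open>Q\<close>: a continuous choice of the polar angle about \<open>Q\<close>
  is nondecreasing.\<close>

definition moves_counterclockwise :: "plane \<Rightarrow> (real \<Rightarrow> plane) \<Rightarrow> bool" where
  "moves_counterclockwise Q g \<longleftrightarrow>
     (\<exists>\<theta> :: real \<Rightarrow> real. continuous_on {0..1} \<theta> \<and> mono_on {0..1} \<theta> \<and>
        (\<forall>t\<in>{0..1}. g t = Q + norm (g t - Q) *\<^sub>R (cos (\<theta> t), sin (\<theta> t))))"

definition taxicab_rotates :: "plane \<Rightarrow> real \<Rightarrow> plane \<Rightarrow> plane \<Rightarrow> bool" where
  "taxicab_rotates Q r P P' \<longleftrightarrow>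
     (if P = Q then P' = Q
      else \<exists>g. path g \<and> pathstart g = P \<and> pathfinish g = P' \<and>
             path_image g \<subseteq> taxicab_circle Q (taxicab_dist P Q) \<and>
             moves_counterclockwise Q (if r \<ge> 0 then g else reversepath g) \<and>
             t_radians_swept Q g = ennreal \<bar>r\<bar>)"

definition taxicab_rotation :: "plane \<Rightarrow> real \<Rightarrow> plane \<Rightarrow> plane" where
  "taxicab_rotation Q r P = (THE P'. taxicab_rotates Q r P P')"

definition taxicab_reflects :: "plane set \<Rightarrow> plane \<Rightarrow> plane \<Rightarrow> bool" where
  "taxicab_reflects l P P' \<longleftrightarrow>
     (if P \<in> l then P' = P
      else midpoint P P' \<in> l \<and>
           taxicab_dist P (midpoint P P') = taxicab_dist P' (midpoint P P') \<and>
           (\<forall>A\<in>l. \<forall>B\<in>l. orthogonal (P' - P) (B - A)))"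

definition taxicab_reflection :: "plane set \<Rightarrow> plane \<Rightarrow> plane" where
  "taxicab_reflection l P = (THE P'. taxicab_reflects l P P')"

definition listed_translations :: "(plane \<Rightarrow> plane) set" where
  "listed_translations = {f. \<exists>a b. f = (\<lambda>(x, y). (x + a, y + b))}"

definition listed_rotations :: "(plane \<Rightarrow> plane) set" where
  "listed_rotations = {f. \<exists>n :: int. f = taxicab_rotation (0, 0) (2 * real_of_int n)}"

definition listed_reflections :: "(plane \<Rightarrow> plane) set" where
  "listed_reflections =
     {taxicab_reflection {(x, y). y = x}, taxicab_reflection {(x, y). y = - x},
      taxicab_reflection {(x, y). y = 0}, taxicab_reflection {(x, y). x = 0}}"

text \<open>On a circle of radius \<open>\<rho>\<close>, an angle of \<open>r\<close> t-radians intercepts an arc of length \<open>r \<rho>\<close>.\<close>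

lemma taxicab_length_eq_t_radians_swept:
  assumes "\<rho> > 0" and "path_image g \<subseteq> taxicab_circle Q \<rho>"
  shows "taxicab_length g = ennreal \<rho> * t_radians_swept Q g"
proof -
  let ?S = "{(n :: nat, t :: nat \<Rightarrow> real). mono_on {..n} t \<and> t ` {..n} \<subseteq> {0..1}}"
  have on: "taxicab_dist (g t) Q = \<rho>" if "t \<in> {0..1}" for t
    using assms(2) that unfolding path_image_def taxicab_circle_def by blast
  have scale: "ennreal (taxicab_dist (g s) (g t)) =
      ennreal \<rho> * ennreal (taxicab_dist (radial_projection Q (g s)) (radial_projection Q (g t)))"
    if "s \<in> {0..1}" "t \<in> {0..1}" for s t
  proof -
    have *: "\<bar>a - b\<bar> = \<rho> * \<bar>(c + (a - c) / \<rho>) - (c + (b - c) / \<rho>)\<bar>" for a b c :: real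
    proof -
      have "(c + (a - c) / \<rho>) - (c + (b - c) / \<rho>) = (a - b) / \<rho>"
        using assms(1) by (simp add: field_simps)
      then show ?thesis using assms(1) by (simp add: abs_div)
    qed
    have "taxicab_dist (g s) (g t) =
        \<rho> * taxicab_dist (radial_projection Q (g s)) (radial_projection Q (g t))"
      unfolding radial_projection_def on[OF that(1)] on[OF that(2)]
      using *[of "fst (g s)" "fst (g t)" "fst Q"] *[of "snd (g s)" "snd (g t)" "snd Q"]
      by (simp add: taxicab_dist_def distrib_left)
    then show ?thesis
      using assms(1) by (simp add: ennreal_mult taxicab_dist_def)
  qed
  have "(\<Sum>i<n. ennreal (taxicab_dist (g (t i)) (g (t (Suc i))))) =
      ennreal \<rho> * (\<Sum>i<n. ennreal (taxicab_dist (radial_projection Q (g (t i)))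
                                               (radial_projection Q (g (t (Suc i))))))"
    if "(n, t) \<in> ?S" for n t
  proof -
    have "t i \<in> {0..1}" if "i \<le> n" for i
      using \<open>(n, t) \<in> ?S\<close> that by blast
    then show ?thesis
      unfolding sum_distrib_left by (intro sum.cong refl scale) simp_all
  qed
  then show ?thesis
    unfolding taxicab_length_def t_radians_swept_def SUP_mult_left_ennreal
    by (intro SUP_cong refl) (auto simp only: split_paired_all prod.case)
qed

end

theory Submission
  imports Defs
begin

text \<open>The point of the unit taxicab circle about the origin at polar angle \<open>\<phi>\<close> is
  \<open>u \<phi> = (cos \<phi>, sin \<phi>) / (\<bar>cos \<phi>\<bar> + \<bar>sin \<phi>\<bar>)\<close>. The arc length \<open>L \<phi>\<close> from \<open>u 0\<close> to \<open>u \<phi>\<close> is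
  strictly increasing in \<open>\<phi>\<close>, the taxicab distance of \<open>u a\<close> and \<open>u b\<close> is at most \<open>L b - L a\<close>, with
  equality when \<open>a \<le> b\<close> lie in the same closed quadrant, so a path with continuous nondecreasing
  polar angle \<open>\<theta>\<close> sweeps out exactly \<open>L (\<theta> 1) - L (\<theta> 0)\<close> t-radians. As \<open>L (\<phi> + \<pi>/2) = L \<phi> + 2\<close>, the
  taxicab rotation by \<open>2 n\<close> t-radians is the Euclidean rotation by \<open>n\<close> right angles, which permutes
  the coordinates up to sign. Each listed reflection is such a signed permutation as well.\<close>

section \<open>Metric properties of the taxicab distance\<close>

lemma taxicab_dist_commute: "taxicab_dist P Q = taxicab_dist Q P"
  by (simp add: taxicab_dist_def abs_minus_commute)

lemma taxicab_dist_triangle: "taxicab_dist P R \<le> taxicab_dist P Q + taxicab_dist Q R"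
  by (simp add: taxicab_dist_def)

lemma taxicab_dist_nonneg: "taxicab_dist P Q \<ge> 0"
  by (simp add: taxicab_dist_def)

lemma taxicab_dist_pos_iff: "taxicab_dist P Q > 0 \<longleftrightarrow> P \<noteq> Q"
  by (auto simp: taxicab_dist_def prod_eq_iff)

section \<open>Length of the reverse path\<close>

text \<open>A subdivision \<open>t\<close> for the reversed path gives the subdivision
  \<open>1 - t (n - i)\<close> for \<open>g\<close> with the same sum. Since reversal is an
  involution, this inequality applied twice yields equality.\<close>

lemma taxicab_length_reversepath_le:
  "taxicab_length (reversepath g) \<le> taxicab_length g"
  unfolding taxicab_length_def
proof (rule SUP_least, clarify)
  fix n and t :: "nat \<Rightarrow> real"
  assume t: "mono_on {..n} t" "t ` {..n} \<subseteq> {0..1}"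
  define s where "s i = 1 - t (n - i)" for i
  have s: "mono_on {..n} s" "s ` {..n} \<subseteq> {0..1}"
    using t by (auto simp: s_def mono_on_def image_subset_iff)
  have "(\<Sum>i<n. ennreal (taxicab_dist (reversepath g (t i)) (reversepath g (t (Suc i))))) =
      (\<Sum>i<n. ennreal (taxicab_dist (g (s i)) (g (s (Suc i)))))"
    by (rule sum.reindex_bij_witness[of _ "\<lambda>i. n - Suc i" "\<lambda>i. n - Suc i"])
      (auto simp: s_def reversepath_def taxicab_dist_commute Suc_diff_Suc)
  also have "\<dots> \<le> (SUP (n, t) \<in> {(n :: nat, t :: nat \<Rightarrow> real).
      mono_on {..n} t \<and> t ` {..n} \<subseteq> {0..1}}.
      \<Sum>i<n. ennreal (taxicab_dist (g (t i)) (g (t (Suc i)))))"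
    using s by (intro SUP_upper2[of "(n, s)"]) auto
  finally show "(\<Sum>i<n. ennreal (taxicab_dist (reversepath g (t i)) (reversepath g (t (Suc i))))) \<le> \<dots>" .
qed

lemma taxicab_length_reversepath: "taxicab_length (reversepath g) = taxicab_length g"
  using taxicab_length_reversepath_le[of g] taxicab_length_reversepath_le[of "reversepath g"]
  by simp

lemma t_radians_swept_reversepath: "t_radians_swept Q (reversepath g) = t_radians_swept Q g"
  using taxicab_length_reversepath[of "\<lambda>t. radial_projection Q (g t)"]
  by (simp add: t_radians_swept_def reversepath_def)

section \<open>The unit taxicab circle\<close>

definition diamond_point :: "real \<Rightarrow> plane" where
  "diamond_point \<phi> = (1 / (\<bar>cos \<phi>\<bar> + \<bar>sin \<phi>\<bar>)) *\<^sub>R (cos \<phi>, sin \<phi>)"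

text \<open>Quadrants are half-open and numbered by all integers: the polar angle is not reduced
  modulo a full turn, so that repeated revolutions are counted.\<close>

definition quadrant :: "real \<Rightarrow> int" where
  "quadrant \<phi> = \<lfloor>\<phi> / (pi / 2)\<rfloor>"

text \<open>Twice the second coordinate of \<open>diamond_point \<psi>\<close> in the first
  quadrant, where the circle is the segment from (1, 0) to (0, 1).\<close>

definition quadrant_arc :: "real \<Rightarrow> real" where
  "quadrant_arc \<psi> = 2 * sin \<psi> / (sin \<psi> + cos \<psi>)"

text \<open>The function \<open>L\<close> of the overview: every completed quadrant contributes a
  side of taxicab length 2.\<close>

definition diamond_arc :: "real \<Rightarrow> real" where
  "diamond_arc \<phi> = 2 * quadrant \<phi> + quadrant_arc (\<phi> - quadrant \<phi> * (pi / 2))"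

definition quarter_turn :: "plane \<Rightarrow> plane" where
  "quarter_turn P = (- snd P, fst P)"

lemma abs_cos_add_abs_sin_pos: "\<bar>cos \<phi>\<bar> + \<bar>sin \<phi>\<bar> > (0 :: real)"
  using sin_cos_squared_add[of \<phi>] by (cases "cos \<phi> = 0") auto

lemma taxicab_dist_diamond_point_0: "taxicab_dist (diamond_point \<phi>) 0 = 1"
  using abs_cos_add_abs_sin_pos[of \<phi>]
  by (simp add: taxicab_dist_def diamond_point_def abs_mult flip: add_divide_distrib)

lemma diamond_point_polar:
  "diamond_point \<phi> = norm (diamond_point \<phi>) *\<^sub>R (cos \<phi>, sin \<phi>)"
  using abs_cos_add_abs_sin_pos[of \<phi>]
  by (simp add: diamond_point_def norm_Pair del: scaleR_Pair)

lemma continuous_on_diamond_point: "continuous_on S diamond_point"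
  unfolding diamond_point_def [abs_def]
  using abs_cos_add_abs_sin_pos by (intro continuous_intros) (auto simp: less_le)

lemma diamond_point_add_quarter: "diamond_point (\<phi> + pi / 2) = quarter_turn (diamond_point \<phi>)"
  by (simp add: diamond_point_def quarter_turn_def sin_add cos_add add.commute)

lemma taxicab_dist_quarter_turn:
  "taxicab_dist (quarter_turn P) (quarter_turn Q) = taxicab_dist P Q"
  by (simp add: taxicab_dist_def quarter_turn_def)

lemma taxicab_dist_funpow_quarter_turn:
  "taxicab_dist ((quarter_turn ^^ n) P) ((quarter_turn ^^ n) Q) = taxicab_dist P Q"
  by (induction n) (simp_all add: taxicab_dist_quarter_turn)

lemma quarter_turn_scaleR: "(quarter_turn ^^ n) (c *\<^sub>R P) = c *\<^sub>R (quarter_turn ^^ n) P"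
  by (induction n) (simp_all add: quarter_turn_def)

lemma bij_funpow_quarter_turn: "bij (quarter_turn ^^ n)"
proof (rule bij_fn)
  show "bij quarter_turn"
    by (rule bij_betwI[where g = "\<lambda>P. (snd P, - fst P)"]) (auto simp: quarter_turn_def)
qed

lemma diamond_point_add_quarters:
  "diamond_point (\<phi> + real n * (pi / 2)) = (quarter_turn ^^ n) (diamond_point \<phi>)"
proof (induction n)
  case (Suc n)
  have "diamond_point (\<phi> + real (Suc n) * (pi / 2)) = diamond_point ((\<phi> + real n * (pi / 2)) + pi / 2)"
    by (simp add: algebra_simps add_divide_distrib)
  with Suc show ?case by (simp add: diamond_point_add_quarter)
qed simp

lemma diamond_dist_add_quarters:
  "taxicab_dist (diamond_point (a + of_int k * (pi / 2))) (diamond_point (b + of_int k * (pi / 2))) =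
     taxicab_dist (diamond_point a) (diamond_point b)"
proof (cases k rule: int_cases2)
  case (nonneg n)
  then show ?thesis
    by (simp add: diamond_point_add_quarters taxicab_dist_funpow_quarter_turn del: times_divide_eq_right)
next
  case (nonpos n)
  \<comment> \<open>For a backward shift, the unshifted point is the image of the shifted one under
    \<open>n\<close> quarter turns.\<close>
  have "diamond_point c = (quarter_turn ^^ n) (diamond_point (c + of_int k * (pi / 2)))" for c
    using diamond_point_add_quarters[of "c + of_int k * (pi / 2)" n] nonpos by simp
  then show ?thesis by (metis taxicab_dist_funpow_quarter_turn)
qed

section \<open>Arc length as a function of the polar angle\<close>

lemma sin_add_cos_pos: "sin \<psi> + cos \<psi> > 0" if "0 \<le> \<psi>" "\<psi> \<le> pi / 2"
  using that abs_cos_add_abs_sin_pos[of \<psi>] sin_ge_zero[of \<psi>] cos_ge_zero[of \<psi>] by simp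

lemma quadrant_arc_0: "quadrant_arc 0 = 0"
  and quadrant_arc_pi_half: "quadrant_arc (pi / 2) = 2"
  by (simp_all add: quadrant_arc_def)

text \<open>Over the common denominator the products of two sines cancel, leaving the subtraction
  formula for the sine.\<close>

lemma quadrant_arc_diff:
  assumes "0 \<le> a" "a \<le> pi / 2" "0 \<le> b" "b \<le> pi / 2"
  shows "quadrant_arc b - quadrant_arc a =
    2 * sin (b - a) / ((sin a + cos a) * (sin b + cos b))"
  using sin_add_cos_pos[OF assms(1,2)] sin_add_cos_pos[OF assms(3,4)]
  by (simp add: quadrant_arc_def sin_diff divide_simps) (simp add: algebra_simps)

lemma quadrant_arc_strict_mono:
  assumes "0 \<le> a" "a < b" "b \<le> pi / 2"
  shows "quadrant_arc a < quadrant_arc b"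
proof -
  have "sin (b - a) > 0" using assms by (intro sin_gt_zero) auto
  then have "quadrant_arc b - quadrant_arc a > 0"
    using assms sin_add_cos_pos[of a] sin_add_cos_pos[of b]
    by (subst quadrant_arc_diff) auto
  then show ?thesis by simp
qed

lemma diamond_dist_first_quadrant:
  assumes "0 \<le> a" "a \<le> b" "b \<le> pi / 2"
  shows "taxicab_dist (diamond_point a) (diamond_point b) = quadrant_arc b - quadrant_arc a"
proof -
  have pt: "diamond_point c = (1 - quadrant_arc c / 2, quadrant_arc c / 2)"
    if "0 \<le> c" "c \<le> pi / 2" for c
    using that sin_add_cos_pos[of c] sin_ge_zero[of c] cos_ge_zero[of c]
    by (simp add: diamond_point_def quadrant_arc_def field_simps)
  have "quadrant_arc a \<le> quadrant_arc b"
    using assms quadrant_arc_strict_mono[of a b] by (cases "a = b") auto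
  with assms show ?thesis by (simp add: pt taxicab_dist_def)
qed

text \<open>At the right endpoint \<open>quadrant\<close> already jumps to \<open>k + 1\<close>, but
  a full arc of 2 replaces the arc 0 of the next quadrant, so the formula for index \<open>k\<close>
  persists there.\<close>

lemma diamond_arc_closed_quadrant:
  assumes "of_int k * (pi / 2) \<le> \<phi>" "\<phi> \<le> (of_int k + 1) * (pi / 2)"
  shows "diamond_arc \<phi> = 2 * of_int k + quadrant_arc (\<phi> - of_int k * (pi / 2))"
proof (cases "\<phi> = (of_int k + 1) * (pi / 2)")
  case True
  then have "quadrant \<phi> = k + 1" by (simp add: quadrant_def)
  moreover have "\<phi> - of_int (k + 1) * (pi / 2) = 0" "\<phi> - of_int k * (pi / 2) = pi / 2"
    using True by (simp_all add: field_simps)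
  ultimately show ?thesis
    by (simp only: diamond_arc_def quadrant_arc_0 quadrant_arc_pi_half) simp
next
  case False
  with assms have "quadrant \<phi> = k"
    unfolding quadrant_def by (intro floor_unique) (simp_all add: field_simps)
  then show ?thesis by (simp add: diamond_arc_def)
qed

lemma quadrant_bounds:
  "of_int (quadrant \<phi>) * (pi / 2) \<le> \<phi>" "\<phi> < (of_int (quadrant \<phi>) + 1) * (pi / 2)"
proof -
  define q where "q = \<phi> / (pi / 2)"
  have "\<phi> = q * (pi / 2)" by (simp add: q_def)
  then show "of_int (quadrant \<phi>) * (pi / 2) \<le> \<phi>" "\<phi> < (of_int (quadrant \<phi>) + 1) * (pi / 2)"
    using floor_correct[of q] by (simp_all add: quadrant_def)
qed

lemma diamond_arc_bounds:
  "2 * of_int (quadrant \<phi>) \<le> diamond_arc \<phi>" "diamond_arc \<phi> < 2 * of_int (quadrant \<phi>) + 2"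
proof -
  define \<psi> where "\<psi> = \<phi> - quadrant \<phi> * (pi / 2)"
  have \<psi>: "0 \<le> \<psi>" "\<psi> < pi / 2"
    using quadrant_bounds[of \<phi>] by (simp_all add: \<psi>_def algebra_simps)
  have "quadrant_arc 0 \<le> quadrant_arc \<psi>"
    using quadrant_arc_strict_mono[of 0 \<psi>] \<psi> by (cases "\<psi> = 0") auto
  moreover have "quadrant_arc \<psi> < quadrant_arc (pi / 2)"
    using quadrant_arc_strict_mono[of \<psi> "pi / 2"] \<psi> by auto
  ultimately show "2 * of_int (quadrant \<phi>) \<le> diamond_arc \<phi>"
      "diamond_arc \<phi> < 2 * of_int (quadrant \<phi>) + 2"
    by (simp_all add: diamond_arc_def \<psi>_def quadrant_arc_0 quadrant_arc_pi_half)
qed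

lemma quadrant_mono: "a \<le> b \<Longrightarrow> quadrant a \<le> quadrant b"
  unfolding quadrant_def by (intro floor_mono divide_right_mono) auto

text \<open>Within a quadrant this is monotonicity of \<open>quadrant_arc\<close>; for different
  quadrants the values lie in disjoint half-open intervals of length 2.\<close>

lemma strict_mono_diamond_arc: "strict_mono diamond_arc"
proof (rule strict_monoI)
  fix a b :: real
  assume "a < b"
  show "diamond_arc a < diamond_arc b"
  proof (cases "quadrant a = quadrant b")
    case True
    with \<open>a < b\<close> show ?thesis
      using quadrant_bounds[of a] quadrant_bounds[of b]
      by (auto simp: diamond_arc_def algebra_simps intro!: quadrant_arc_strict_mono)
  next
    case False
    with \<open>a < b\<close> quadrant_mono[of a b] have "quadrant a + 1 \<le> quadrant b" by simp
    then have "real_of_int (quadrant a) + 1 \<le> quadrant b" by linarith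
    then show ?thesis
      using diamond_arc_bounds[of a] diamond_arc_bounds[of b] by linarith
  qed
qed

lemma diamond_arc_add_quarters: "diamond_arc (\<phi> + real n * (pi / 2)) = diamond_arc \<phi> + 2 * real n"
proof -
  have "(\<phi> + real n * (pi / 2)) / (pi / 2) = \<phi> / (pi / 2) + of_int (int n)"
    by (simp add: field_simps)
  then have "quadrant (\<phi> + real n * (pi / 2)) = quadrant \<phi> + int n"
    unfolding quadrant_def by (simp only: floor_add_int)
  then show ?thesis by (simp add: diamond_arc_def algebra_simps)
qed

lemma diamond_dist_same_quadrant:
  assumes "of_int k * (pi / 2) \<le> a" "a \<le> b" "b \<le> (of_int k + 1) * (pi / 2)"
  shows "taxicab_dist (diamond_point a) (diamond_point b) = diamond_arc b - diamond_arc a"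
proof -
  have "taxicab_dist (diamond_point a) (diamond_point b) =
      quadrant_arc (b - of_int k * (pi / 2)) - quadrant_arc (a - of_int k * (pi / 2))"
    using assms
      diamond_dist_add_quarters[of "a - of_int k * (pi / 2)" k "b - of_int k * (pi / 2)"]
    by (subst diamond_dist_first_quadrant [symmetric]) (auto simp: algebra_simps)
  moreover have "diamond_arc a = 2 * of_int k + quadrant_arc (a - of_int k * (pi / 2))"
    using assms by (intro diamond_arc_closed_quadrant) linarith+
  moreover have "diamond_arc b = 2 * of_int k + quadrant_arc (b - of_int k * (pi / 2))"
    using assms by (intro diamond_arc_closed_quadrant) linarith+
  ultimately show ?thesis by linarith
qed

text \<open>In one quadrant equality holds; in adjacent ones the triangle inequality is applied at
  the vertex between them. Otherwise the distance is at most the diameter 2, while the arc lengths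
  differ by more than 2.\<close>

lemma diamond_dist_le:
  assumes "a \<le> b"
  shows "taxicab_dist (diamond_point a) (diamond_point b) \<le> diamond_arc b - diamond_arc a"
proof -
  let ?ka = "quadrant a" and ?kb = "quadrant b"
  consider "?kb = ?ka" | "?kb = ?ka + 1" | "?kb \<ge> ?ka + 2"
    using quadrant_mono[OF assms] by linarith
  then show ?thesis
  proof cases
    case 1
    then show ?thesis
      using diamond_dist_same_quadrant[of ?ka a b] quadrant_bounds[of a] quadrant_bounds[of b] assms
      by simp
  next
    case 2
    define c where "c = of_int ?kb * (pi / 2)"
    have "taxicab_dist (diamond_point a) (diamond_point c) = diamond_arc c - diamond_arc a"
      using 2 quadrant_bounds[of a] by (intro diamond_dist_same_quadrant[of ?ka]) (auto simp: c_def)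
    moreover have "taxicab_dist (diamond_point c) (diamond_point b) = diamond_arc b - diamond_arc c"
      using quadrant_bounds[of b] by (intro diamond_dist_same_quadrant[of ?kb]) (auto simp: c_def)
    ultimately show ?thesis
      using taxicab_dist_triangle[of "diamond_point a" "diamond_point b" "diamond_point c"] by simp
  next
    case 3
    have "taxicab_dist (diamond_point a) (diamond_point b) \<le> 2"
      using taxicab_dist_triangle[of "diamond_point a" "diamond_point b" 0]
        taxicab_dist_commute[of 0 "diamond_point b"]
      by (simp add: taxicab_dist_diamond_point_0)
    moreover have "real_of_int ?ka + 2 \<le> ?kb" using 3 by linarith
    ultimately show ?thesis
      using diamond_arc_bounds[of a] diamond_arc_bounds[of b] by linarith
  qed
qed

section \<open>Paths with monotone polar angle\<close>

text \<open>Each subdivision sum is dominated by a telescoping sum of increments of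
  \<open>diamond_arc\<close>.\<close>

lemma taxicab_length_diamond_le:
  assumes mono: "mono_on {0..1} \<theta>" and h: "\<And>t. t \<in> {0..1} \<Longrightarrow> h t = diamond_point (\<theta> t)"
  shows "taxicab_length h \<le> ennreal (diamond_arc (\<theta> 1) - diamond_arc (\<theta> 0))"
  unfolding taxicab_length_def
proof (rule SUP_least, clarify)
  fix n and t :: "nat \<Rightarrow> real"
  assume t: "mono_on {..n} t" "t ` {..n} \<subseteq> {0..1}"
  have t01: "t i \<in> {0..1}" if "i \<le> n" for i using t(2) that by blast
  have arc: "diamond_arc a \<le> diamond_arc b" if "a \<le> b" for a b
    using strict_mono_diamond_arc that strict_mono_less_eq by blast
  have le: "taxicab_dist (h (t i)) (h (t (Suc i))) \<le>
      diamond_arc (\<theta> (t (Suc i))) - diamond_arc (\<theta> (t i))" if "i < n" for i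
  proof -
    have "t i \<le> t (Suc i)" using that by (intro mono_onD[OF t(1)]) auto
    then have "\<theta> (t i) \<le> \<theta> (t (Suc i))"
      using that by (intro mono_onD[OF mono] t01) auto
    moreover have "h (t i) = diamond_point (\<theta> (t i))"
        "h (t (Suc i)) = diamond_point (\<theta> (t (Suc i)))"
      using that by (intro h t01; simp)+
    ultimately show ?thesis by (simp only: diamond_dist_le)
  qed
  have "(\<Sum>i<n. taxicab_dist (h (t i)) (h (t (Suc i)))) \<le>
      (\<Sum>i<n. diamond_arc (\<theta> (t (Suc i))) - diamond_arc (\<theta> (t i)))"
    using le by (intro sum_mono) auto
  also have "\<dots> = diamond_arc (\<theta> (t n)) - diamond_arc (\<theta> (t 0))"
    by (rule sum_lessThan_telescope[of "\<lambda>i. diamond_arc (\<theta> (t i))"])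
  also have "\<dots> \<le> diamond_arc (\<theta> 1) - diamond_arc (\<theta> 0)"
    using t01[of 0] t01[of n] by (intro diff_mono arc mono_onD[OF mono]) auto
  finally show "(\<Sum>i<n. ennreal (taxicab_dist (h (t i)) (h (t (Suc i))))) \<le>
      ennreal (diamond_arc (\<theta> 1) - diamond_arc (\<theta> 0))"
    by (simp add: taxicab_dist_nonneg sum_ennreal ennreal_leI)
qed

text \<open>The subdivision attaining the length cuts the path where the polar angle crosses a multiple
  of \<open>\<pi>/2\<close>.\<close>

lemma taxicab_length_diamond_ge:
  assumes cont: "continuous_on {0..1} \<theta>" and mono: "mono_on {0..1} \<theta>"
    and h: "\<And>t. t \<in> {0..1} \<Longrightarrow> h t = diamond_point (\<theta> t)"
  shows "ennreal (diamond_arc (\<theta> 1) - diamond_arc (\<theta> 0)) \<le> taxicab_length h"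
proof -
  have le01: "\<theta> 0 \<le> \<theta> 1" by (rule mono_onD[OF mono]) auto
  define k where "k = quadrant (\<theta> 0)"
  \<comment> \<open>The number of quadrants from that of \<open>\<theta> 0\<close> to that of
    \<open>\<theta> 1\<close>, both included; the \<open>+ 1\<close> puts the last cut angle beyond
    \<open>\<theta> 1\<close>.\<close>
  define n where "n = nat (quadrant (\<theta> 1) - k + 1)"
  \<comment> \<open>Multiples of a right angle, clamped to the range of \<theta> so that the first
    and last cuts are its endpoints.\<close>
  define \<psi> where "\<psi> i = max (\<theta> 0) (min (\<theta> 1) (of_int (k + int i) * (pi / 2)))" for i
  have n: "of_int (k + int n) = real_of_int (quadrant (\<theta> 1)) + 1"
    using quadrant_mono[OF le01] by (simp add: n_def k_def)
  have \<psi>0: "\<psi> 0 = \<theta> 0"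
    using quadrant_bounds(1)[of "\<theta> 0"] le01 by (simp add: \<psi>_def k_def)
  have \<psi>n: "\<psi> n = \<theta> 1"
    using quadrant_bounds(2)[of "\<theta> 1"] le01 unfolding \<psi>_def n by linarith
  have \<psi>_mono: "\<psi> i \<le> \<psi> j" if "i \<le> j" for i j
  proof -
    have "real_of_int (k + int i) * (pi / 2) \<le> of_int (k + int j) * (pi / 2)"
      using that by (intro mult_right_mono) auto
    then show ?thesis unfolding \<psi>_def by linarith
  qed
  have "\<exists>s. s \<in> {0..1} \<and> \<theta> s = y" if "y \<in> {\<theta> 0..\<theta> 1}" for y
    using IVT'[of \<theta> 0 y 1] that cont by auto
  then obtain \<tau> where \<tau>: "\<tau> y \<in> {0..1}" "\<theta> (\<tau> y) = y" if "y \<in> {\<theta> 0..\<theta> 1}" for y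
    by metis
  have \<psi>_in: "\<psi> i \<in> {\<theta> 0..\<theta> 1}" for i using le01 by (auto simp: \<psi>_def)
  define t where "t = (\<lambda>i. \<tau> (\<psi> i))"
  have t01: "t i \<in> {0..1}" and \<theta>t: "\<theta> (t i) = \<psi> i" for i
    using \<tau>[OF \<psi>_in] by (simp_all add: t_def)
  have t_mono: "mono_on {..n} t"
  proof (rule mono_onI)
    fix i j :: nat assume "i \<le> j"
    show "t i \<le> t j"
    proof (rule ccontr)
      assume less: "\<not> t i \<le> t j"
      then have "\<theta> (t j) \<le> \<theta> (t i)" by (intro mono_onD[OF mono] t01) auto
      \<comment> \<open>Times in the wrong order force equal angles, and \<tau> chooses the same
        time for equal angles even where \<theta> is constant on an interval.\<close>
      with \<psi>_mono[OF \<open>i \<le> j\<close>] have "\<psi> i = \<psi> j" by (simp add: \<theta>t)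
      with less show False by (simp add: t_def)
    qed
  qed
  have dist: "taxicab_dist (h (t i)) (h (t (Suc i))) = diamond_arc (\<psi> (Suc i)) - diamond_arc (\<psi> i)"
    for i
  proof (cases "\<psi> i = \<psi> (Suc i)")
    case True
    then show ?thesis by (simp add: t_def taxicab_dist_def)
  next
    case False
    have eq: "real_of_int (k + int (Suc i)) * (pi / 2) = (of_int (k + int i) + 1) * (pi / 2)" by simp
    \<comment> \<open>As the two cuts differ, the lower one was not clamped down to
      \<open>\<theta> 1\<close> and the upper one not clamped up to \<open>\<theta> 0\<close>; hence
      both lie in closed quadrant \<open>k + i\<close>.\<close>
    have "of_int (k + int i) * (pi / 2) \<le> \<psi> i" "\<psi> (Suc i) \<le> (of_int (k + int i) + 1) * (pi / 2)"
      using False \<psi>_mono[of i "Suc i"] unfolding \<psi>_def eq by linarith+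
    then show ?thesis
      using \<psi>_mono[of i "Suc i"] t01 by (simp add: h \<theta>t diamond_dist_same_quadrant[of "k + int i"])
  qed
  have "(\<Sum>i<n. taxicab_dist (h (t i)) (h (t (Suc i)))) = diamond_arc (\<theta> 1) - diamond_arc (\<theta> 0)"
    using sum_lessThan_telescope[of "\<lambda>i. diamond_arc (\<psi> i)" n] by (simp add: dist \<psi>0 \<psi>n)
  then have "ennreal (diamond_arc (\<theta> 1) - diamond_arc (\<theta> 0)) =
      (\<Sum>i<n. ennreal (taxicab_dist (h (t i)) (h (t (Suc i)))))"
    by (simp add: taxicab_dist_nonneg sum_ennreal)
  also have "\<dots> \<le> taxicab_length h"
    unfolding taxicab_length_def
    using t01 t_mono by (intro SUP_upper2[of "(n, t)"]) auto
  finally show ?thesis .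
qed

lemma taxicab_length_diamond:
  assumes "continuous_on {0..1} \<theta>" "mono_on {0..1} \<theta>"
    and "\<And>t. t \<in> {0..1} \<Longrightarrow> h t = diamond_point (\<theta> t)"
  shows "taxicab_length h = ennreal (diamond_arc (\<theta> 1) - diamond_arc (\<theta> 0))"
  using taxicab_length_diamond_le[OF assms(2,3)] taxicab_length_diamond_ge[OF assms] by (rule antisym)

text \<open>Converts the Euclidean polar form in \<open>moves_counterclockwise\<close> to the
  taxicab radius, which is the norm times
  \<open>\<bar>cos \<phi>\<bar> + \<bar>sin \<phi>\<bar>\<close>.\<close>

lemma taxicab_circle_polar:
  assumes "taxicab_dist P 0 = \<rho>" "P = norm P *\<^sub>R (cos \<phi>, sin \<phi>)"
  shows "P = \<rho> *\<^sub>R diamond_point \<phi>"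
proof -
  define m where "m = norm P"
  have P: "P = (m * cos \<phi>, m * sin \<phi>)" "m \<ge> 0" using assms(2) by (simp_all add: m_def)
  then have "\<rho> = m * (\<bar>cos \<phi>\<bar> + \<bar>sin \<phi>\<bar>)"
    using assms(1) by (simp add: taxicab_dist_def abs_mult distrib_left)
  then show ?thesis
    using abs_cos_add_abs_sin_pos[of \<phi>] P by (simp add: diamond_point_def)
qed

lemma radial_projection_0:
  assumes "P = \<rho> *\<^sub>R diamond_point \<phi>" "\<rho> > 0"
  shows "radial_projection 0 P = diamond_point \<phi>"
proof -
  have "taxicab_dist P 0 = \<rho> * taxicab_dist (diamond_point \<phi>) 0"
    using assms by (simp add: taxicab_dist_def abs_mult distrib_left)
  then show ?thesis
    using assms by (simp add: radial_projection_def taxicab_dist_diamond_point_0)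
qed

section \<open>Taxicab rotations by even angles\<close>

text \<open>The swept measure fixes the increment of \<open>diamond_arc\<close> whatever the path;
  injectivity of \<open>diamond_arc\<close> then fixes the final polar angle.\<close>

lemma taxicab_rotates_even_imp:
  assumes "taxicab_rotates 0 (2 * real n) P P'"
  shows "P' = (quarter_turn ^^ n) P"
proof (cases "P = 0")
  case True
  with assms show ?thesis
    \<comment> \<open>Scaling by 0 shows that the iterated quarter turn fixes the origin.\<close>
    using quarter_turn_scaleR[of n 0 0] by (simp add: taxicab_rotates_def)
next
  case False
  define \<rho> where "\<rho> = taxicab_dist P 0"
  have "\<rho> > 0" using False by (simp add: \<rho>_def taxicab_dist_pos_iff)
  from assms False obtain g where g: "pathstart g = P" "pathfinish g = P'"
      "path_image g \<subseteq> taxicab_circle 0 \<rho>" "moves_counterclockwise 0 g"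
      "t_radians_swept 0 g = ennreal (2 * real n)"
    unfolding taxicab_rotates_def \<rho>_def by auto
  from g(4) obtain \<theta> where \<theta>: "continuous_on {0..1} \<theta>" "mono_on {0..1} \<theta>"
      "\<And>t. t \<in> {0..1} \<Longrightarrow> g t = norm (g t) *\<^sub>R (cos (\<theta> t), sin (\<theta> t))"
    unfolding moves_counterclockwise_def by auto
  have gt: "g t = \<rho> *\<^sub>R diamond_point (\<theta> t)" if "t \<in> {0..1}" for t
  proof (rule taxicab_circle_polar[OF _ \<theta>(3)[OF that]])
    show "taxicab_dist (g t) 0 = \<rho>"
      using g(3) that unfolding path_image_def taxicab_circle_def by blast
  qed
  have "ennreal (diamond_arc (\<theta> 1) - diamond_arc (\<theta> 0)) = ennreal (2 * real n)"
    using taxicab_length_diamond[OF \<theta>(1,2), of "\<lambda>t. radial_projection 0 (g t)"]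
      radial_projection_0[OF gt \<open>\<rho> > 0\<close>] g(5)
    by (simp add: t_radians_swept_def)
  \<comment> \<open>\<open>ennreal\<close> sends negative reals to 0, so nonnegativity is what turns
    the equation above into one between reals.\<close>
  moreover have "diamond_arc (\<theta> 0) \<le> diamond_arc (\<theta> 1)"
    using \<theta>(2) strict_mono_diamond_arc by (auto simp: strict_mono_less_eq mono_on_def)
  ultimately have "diamond_arc (\<theta> 1) = diamond_arc (\<theta> 0 + real n * (pi / 2))"
    using diamond_arc_add_quarters[of "\<theta> 0" n] by simp
  then have "\<theta> 1 = \<theta> 0 + real n * (pi / 2)"
    using strict_mono_diamond_arc strict_mono_eq by blast
  then have "diamond_point (\<theta> 1) = (quarter_turn ^^ n) (diamond_point (\<theta> 0))"
    by (simp only: diamond_point_add_quarters)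
  then have "g 1 = (quarter_turn ^^ n) (g 0)"
    by (simp add: gt quarter_turn_scaleR)
  then show ?thesis using g(1,2) by (simp add: pathstart_def pathfinish_def)
qed

lemma polar_coordinates_exist: "\<exists>\<phi>. P = norm P *\<^sub>R (cos \<phi>, sin \<phi>)" for P :: plane
proof (cases "P = 0")
  case False
  have "(fst P / norm P)\<^sup>2 + (snd P / norm P)\<^sup>2 = (norm P)\<^sup>2 / (norm P)\<^sup>2"
    by (simp add: power_divide norm_prod_def flip: add_divide_distrib)
  also have "\<dots> = 1" using False by simp
  finally obtain \<phi> where "fst P / norm P = cos \<phi>" "snd P / norm P = sin \<phi>"
    using sincos_total_2pi by metis
  then have "cos \<phi> = fst P / norm P" "sin \<phi> = snd P / norm P" by simp_all
  then have "P = norm P *\<^sub>R (cos \<phi>, sin \<phi>)" using False by simp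
  then show ?thesis ..
qed (simp add: zero_prod_def)

lemma taxicab_rotates_even: "taxicab_rotates 0 (2 * real n) P ((quarter_turn ^^ n) P)"
proof (cases "P = 0")
  case True
  then show ?thesis
    using quarter_turn_scaleR[of n 0 0] by (simp add: taxicab_rotates_def)
next
  case False
  define \<rho> where "\<rho> = taxicab_dist P 0"
  have "\<rho> > 0" using False by (simp add: \<rho>_def taxicab_dist_pos_iff)
  obtain \<phi> where "P = norm P *\<^sub>R (cos \<phi>, sin \<phi>)" using polar_coordinates_exist by blast
  then have P: "P = \<rho> *\<^sub>R diamond_point \<phi>" by (intro taxicab_circle_polar) (simp add: \<rho>_def)
  \<comment> \<open>The witnessing path turns at constant angular speed through \<open>n\<close>
    right angles.\<close>
  define \<theta> where "\<theta> t = \<phi> + t * (real n * (pi / 2))" for t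
  define g where "g t = \<rho> *\<^sub>R diamond_point (\<theta> t)" for t
  have cont: "continuous_on {0..1} \<theta>" unfolding \<theta>_def [abs_def] by (intro continuous_intros)
  have mono: "mono_on {0..1} \<theta>" by (auto simp: \<theta>_def mono_on_def intro!: mult_right_mono)
  have "path g"
    unfolding path_def g_def [abs_def]
    by (intro continuous_intros continuous_on_compose2[OF continuous_on_diamond_point cont]) auto
  moreover have "pathstart g = P" by (simp add: pathstart_def g_def \<theta>_def P)
  moreover have "pathfinish g = (quarter_turn ^^ n) P"
    using diamond_point_add_quarters[of \<phi> n]
    by (simp add: pathfinish_def g_def \<theta>_def P quarter_turn_scaleR)
  moreover have "path_image g \<subseteq> taxicab_circle 0 (taxicab_dist P 0)"
  proof -
    have "taxicab_dist (g t) 0 = \<rho> * taxicab_dist (diamond_point (\<theta> t)) 0" for t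
      using \<open>\<rho> > 0\<close> by (simp add: g_def taxicab_dist_def abs_mult distrib_left)
    then show ?thesis
      by (auto simp: path_image_def taxicab_circle_def taxicab_dist_diamond_point_0 \<rho>_def)
  qed
  moreover have "moves_counterclockwise 0 g"
  proof -
    have "g t = norm (g t) *\<^sub>R (cos (\<theta> t), sin (\<theta> t))" for t
      using diamond_point_polar[of "\<theta> t"] \<open>\<rho> > 0\<close> unfolding g_def
      by (metis abs_of_pos norm_scaleR scaleR_scaleR)
    then show ?thesis using cont mono by (auto simp: moves_counterclockwise_def)
  qed
  moreover have "t_radians_swept 0 g = ennreal (2 * real n)"
    using taxicab_length_diamond[OF cont mono, of "\<lambda>t. radial_projection 0 (g t)"]
      radial_projection_0[OF g_def \<open>\<rho> > 0\<close>] diamond_arc_add_quarters[of \<phi> n]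
    by (simp add: t_radians_swept_def \<theta>_def)
  ultimately show ?thesis using False by (auto simp: taxicab_rotates_def)
qed

lemma taxicab_rotates_even_iff:
  "taxicab_rotates 0 (2 * real n) P P' \<longleftrightarrow> P' = (quarter_turn ^^ n) P"
  using taxicab_rotates_even taxicab_rotates_even_imp by blast

text \<open>The reversed path is the witness. For nonzero \<open>r\<close>, exactly one of
  \<open>r\<close> and \<open>- r\<close> asks for counterclockwise motion, so the orientation test
  switches.\<close>

lemma taxicab_rotates_uminus_imp:
  assumes "taxicab_rotates Q r P P'" "r \<noteq> 0"
  shows "taxicab_rotates Q (- r) P' P"
proof (cases "P = Q")
  case True
  with assms show ?thesis by (simp add: taxicab_rotates_def)
next
  case False
  with assms obtain g where g: "path g" "pathstart g = P" "pathfinish g = P'"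
      "path_image g \<subseteq> taxicab_circle Q (taxicab_dist P Q)"
      "moves_counterclockwise Q (if r \<ge> 0 then g else reversepath g)"
      "t_radians_swept Q g = ennreal \<bar>r\<bar>"
    unfolding taxicab_rotates_def by auto
  \<comment> \<open>The endpoint stays on the circle, so it differs from the center and the path
    clause applies to it with the same radius.\<close>
  have "P' \<in> path_image g" using g(3) pathfinish_in_path_image by blast
  with g(4) have dist: "taxicab_dist P' Q = taxicab_dist P Q" by (auto simp: taxicab_circle_def)
  with False have "P' \<noteq> Q" using taxicab_dist_pos_iff by metis
  moreover have "moves_counterclockwise Q (if - r \<ge> 0 then reversepath g else reversepath (reversepath g))"
    using g(5) assms(2) by (auto split: if_splits)
  ultimately show ?thesis
    using g(1-4,6) unfolding taxicab_rotates_def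
    by (auto simp: dist t_radians_swept_reversepath intro!: exI[of _ "reversepath g"])
qed

lemma taxicab_rotates_uminus_iff:
  "r \<noteq> 0 \<Longrightarrow> taxicab_rotates Q (- r) P P' \<longleftrightarrow> taxicab_rotates Q r P' P"
  using taxicab_rotates_uminus_imp[of Q r P' P] taxicab_rotates_uminus_imp[of Q "- r" P P'] by auto

lemma taxicab_rotation_even: "taxicab_rotation 0 (2 * real n) = quarter_turn ^^ n"
  by (simp add: fun_eq_iff taxicab_rotation_def taxicab_rotates_even_iff)

lemma taxicab_rotation_minus_even: "taxicab_rotation 0 (- (2 * real n)) = inv (quarter_turn ^^ n)"
\<comment> \<open>Exchanging the endpoints requires a nonzero angle, so the zero rotation is treated
  as the identity.\<close>
proof (cases "n = 0")
  case True
  then show ?thesis using taxicab_rotation_even[of 0] by (simp add: fun_eq_iff inv_def)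
next
  case False
  have "taxicab_rotates 0 (- (2 * real n)) P P' \<longleftrightarrow> P' = inv (quarter_turn ^^ n) P" for P P'
    using False bij_funpow_quarter_turn[of n]
    by (subst taxicab_rotates_uminus_iff) (auto simp: taxicab_rotates_even_iff bij_inv_eq_iff)
  then show ?thesis by (simp add: fun_eq_iff taxicab_rotation_def)
qed

section \<open>Isometries\<close>

lemma taxicab_isometry_listed_translations:
  "f \<in> listed_translations \<Longrightarrow> taxicab_isometry f"
  by (auto simp: listed_translations_def taxicab_isometry_def taxicab_dist_def)

lemma taxicab_isometry_listed_rotations:
  assumes "f \<in> listed_rotations"
  shows "taxicab_isometry f"
proof -
  have iso: "taxicab_isometry (quarter_turn ^^ n)" for n
    by (simp add: taxicab_isometry_def taxicab_dist_funpow_quarter_turn)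
  have iso_inv: "taxicab_isometry (inv (quarter_turn ^^ n))" for n
    unfolding taxicab_isometry_def
    by (metis bij_funpow_quarter_turn bij_is_surj surj_f_inv_f taxicab_dist_funpow_quarter_turn)
  obtain k :: int where f: "f = taxicab_rotation 0 (2 * of_int k)"
    using assms by (auto simp: listed_rotations_def zero_prod_def)
  show ?thesis
  proof (cases k rule: int_cases2)
    case (nonneg n)
    then show ?thesis using iso[of n] taxicab_rotation_even[of n] f by simp
  next
    case (nonpos n)
    then show ?thesis
      using iso_inv[of n] taxicab_rotation_minus_even[of n] f by simp
  qed
qed

text \<open>The midpoints of \<open>P\<close> with two reflections \<open>P'\<close> and \<open>P''\<close> differ by \<open>(P' - P'') / 2\<close>, so
  \<open>P' - P''\<close> is orthogonal to itself.\<close>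

lemma taxicab_reflects_unique:
  assumes "taxicab_reflects l P P'" "taxicab_reflects l P P''"
  shows "P' = P''"
proof (cases "P \<in> l")
  case True
  with assms show ?thesis by (simp add: taxicab_reflects_def)
next
  case False
  have eq: "midpoint P P' - midpoint P P'' = (1 / 2) *\<^sub>R (P' - P'')"
    by (simp add: midpoint_def algebra_simps)
  have "orthogonal (P' - P) (midpoint P P' - midpoint P P'')"
      "orthogonal (P'' - P) (midpoint P P' - midpoint P P'')"
    using assms False by (simp_all add: taxicab_reflects_def)
  then have "(P' - P) \<bullet> (P' - P'') = 0" "(P'' - P) \<bullet> (P' - P'') = 0"
    by (simp_all add: eq orthogonal_def)
  then have "(P' - P'') \<bullet> (P' - P'') = 0" by (simp add: inner_diff_left)
  then show ?thesis by simp
qed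

text \<open>The displacements from the midpoint to the two endpoints are opposite, which gives the
  distance clause; uniqueness of the reflected point resolves the definite description.\<close>

lemma taxicab_reflection_eqI:
  assumes "\<And>P. P \<in> l \<Longrightarrow> F P = P" "\<And>P. midpoint P (F P) \<in> l"
    and "\<And>P A B. A \<in> l \<Longrightarrow> B \<in> l \<Longrightarrow> orthogonal (F P - P) (B - A)"
  shows "taxicab_reflection l = F"
proof
  fix P
  have "taxicab_dist P (midpoint P Q) = taxicab_dist Q (midpoint P Q)" for Q
    by (simp add: taxicab_dist_def midpoint_def field_simps abs_minus_commute)
  with assms have "taxicab_reflects l P (F P)" by (simp add: taxicab_reflects_def)
  then show "taxicab_reflection l P = F P"
    unfolding taxicab_reflection_def using taxicab_reflects_unique by (intro the_equality)
qed

section \<open>Coordinate formulas for the four reflections\<close>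

lemma taxicab_reflection_diagonal: "taxicab_reflection {(x, y). y = x} = (\<lambda>(x, y). (y, x))"
  by (rule taxicab_reflection_eqI) (auto simp: midpoint_def orthogonal_def algebra_simps)

lemma taxicab_reflection_antidiagonal: "taxicab_reflection {(x, y). y = - x} = (\<lambda>(x, y). (- y, - x))"
  by (rule taxicab_reflection_eqI) (auto simp: midpoint_def orthogonal_def algebra_simps)

lemma taxicab_reflection_horizontal: "taxicab_reflection {(x, y). y = 0} = (\<lambda>(x, y). (x, - y))"
  by (rule taxicab_reflection_eqI) (auto simp: midpoint_def orthogonal_def algebra_simps)

lemma taxicab_reflection_vertical: "taxicab_reflection {(x, y). x = 0} = (\<lambda>(x, y). (- x, y))"
  by (rule taxicab_reflection_eqI) (auto simp: midpoint_def orthogonal_def algebra_simps)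

lemma taxicab_isometry_listed_reflections:
  "f \<in> listed_reflections \<Longrightarrow> taxicab_isometry f"
  by (auto simp: listed_reflections_def taxicab_isometry_def taxicab_dist_def
      taxicab_reflection_diagonal taxicab_reflection_antidiagonal
      taxicab_reflection_horizontal taxicab_reflection_vertical)

text \<open>Induction on the list; the empty composition is \<open>id\<close>.\<close>

lemma taxicab_isometry_foldr_comp:
  "(\<And>f. f \<in> set fs \<Longrightarrow> taxicab_isometry f) \<Longrightarrow> taxicab_isometry (foldr (\<circ>) fs id)"
proof (induction fs)
  case (Cons f fs)
  have "taxicab_isometry f" by (rule Cons.prems) simp
  moreover have "taxicab_isometry (foldr (\<circ>) fs id)"
    by (rule Cons.IH, rule Cons.prems) simp
  ultimately show ?case unfolding taxicab_isometry_def foldr.simps comp_apply by metis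
qed (simp add: taxicab_isometry_def)

theorem theorem3p11:
  shows "(\<forall>fs :: (plane \<Rightarrow> plane) list.
            set fs \<subseteq> listed_translations \<union> listed_rotations \<union> listed_reflections \<longrightarrow>
            taxicab_isometry (foldr (\<circ>) fs id)) \<and>
         (\<forall>f \<in> listed_translations \<union> listed_rotations \<union> listed_reflections.
            taxicab_isometry f)"
  using taxicab_isometry_listed_translations taxicab_isometry_listed_rotations
    taxicab_isometry_listed_reflections
  by (blast intro: taxicab_isometry_foldr_comp)

end
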